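(* Let $\Gamma$ be the $3$-regular tree and $\Gamma_0$ its edge graph, with graph distance $d$. For $z\in\Gamma_0$ let $F_z(x)=\frac1{\sqrt3}\left(-\frac12\right)^{d(x,z)}$, $x\in\Gamma_0$. Let $E_6$ be the space of $F\in\ell^2(\Gamma_0)$ with $-\Delta_{\Gamma_0}F=6F$. Then for any $F\in E_6$, $$\sum_{z\in\Gamma_0}|\langle F,F_z\rangle|^2=3\,\|F\|_{\ell^2(\Gamma_0)}^2 .$$
   Context: The edge graph $\Gamma_0$ has the edges of $\Gamma$ as vertices, two being adjacent iff they share an endpoint (it is $4$-regular). $\Delta_{\Gamma_0}F(x)=\sum_{y\sim x}(F(y)-F(x))$. $\langle\cdot,\cdot\rangle$ is the $\ell^2(\Gamma_0)$ inner product with respect to counting measure. *)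

theory Defs
  imports "HOL-Analysis.Analysis"
begin

record 'v graph =
  verts :: "'v set"
  edges :: "'v set set"

definition simple_graph :: "'v graph \<Rightarrow> bool" where
  "simple_graph G \<longleftrightarrow> (\<forall>e\<in>edges G. e \<subseteq> verts G \<and> card e = 2)"

definition neighbours :: "'v graph \<Rightarrow> 'v \<Rightarrow> 'v set" where
  "neighbours G x = {y. {x, y} \<in> edges G}"

definition regular :: "nat \<Rightarrow> 'v graph \<Rightarrow> bool" where
  "regular k G \<longleftrightarrow> (\<forall>x\<in>verts G. finite (neighbours G x) \<and> card (neighbours G x) = k)"

text \<open>A walk is the nonempty list of the vertices it visits; its number of steps is
  one less than the length of the list.\<close>

definition walk :: "'v graph \<Rightarrow> 'v list \<Rightarrow> bool" where
  "walk G p \<longleftrightarrow> p \<noteq> [] \<and> set p \<subseteq> verts G \<and> successively (\<lambda>x y. {x, y} \<in> edges G) p"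

definition walk_between :: "'v graph \<Rightarrow> 'v \<Rightarrow> 'v list \<Rightarrow> 'v \<Rightarrow> bool" where
  "walk_between G x p y \<longleftrightarrow> walk G p \<and> hd p = x \<and> last p = y"

definition connected_graph :: "'v graph \<Rightarrow> bool" where
  "connected_graph G \<longleftrightarrow> verts G \<noteq> {} \<and> (\<forall>x\<in>verts G. \<forall>y\<in>verts G. \<exists>p. walk_between G x p y)"

text \<open>The closing vertex of a cycle is not repeated; the bound 3 on the length excludes going
  back and forth along one edge.\<close>

definition cycle :: "'v graph \<Rightarrow> 'v list \<Rightarrow> bool" where
  "cycle G p \<longleftrightarrow> walk G p \<and> distinct p \<and> 3 \<le> length p \<and> {last p, hd p} \<in> edges G"

definition tree :: "'v graph \<Rightarrow> bool" where
  "tree G \<longleftrightarrow> simple_graph G \<and> connected_graph G \<and> (\<nexists>p. cycle G p)"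

text \<open>Only meaningful for vertices joined by a walk.\<close>

definition graph_dist :: "'v graph \<Rightarrow> 'v \<Rightarrow> 'v \<Rightarrow> nat" where
  "graph_dist G x y = (LEAST n. \<exists>p. walk_between G x p y \<and> length p = Suc n)"

definition edge_graph :: "'v graph \<Rightarrow> 'v set graph" where
  "edge_graph G =
     \<lparr>verts = edges G,
      edges = {{e, f} | e f. e \<in> edges G \<and> f \<in> edges G \<and> e \<noteq> f \<and> e \<inter> f \<noteq> {}}\<rparr>"

text \<open>A function on the vertices of \<open>G\<close> is a function on the whole vertex type, whose values outside
  \<^term>\<open>verts G\<close> are ignored.\<close>

definition laplacian :: "'v graph \<Rightarrow> ('v \<Rightarrow> complex) \<Rightarrow> 'v \<Rightarrow> complex" where
  "laplacian G F x = (\<Sum>y\<in>neighbours G x. F y - F x)"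

definition l2 :: "'v graph \<Rightarrow> ('v \<Rightarrow> complex) set" where
  "l2 G = {F. (\<lambda>x. (cmod (F x))\<^sup>2) summable_on verts G}"

definition l2_inner :: "'v graph \<Rightarrow> ('v \<Rightarrow> complex) \<Rightarrow> ('v \<Rightarrow> complex) \<Rightarrow> complex" where
  "l2_inner G F H = (\<Sum>\<^sub>\<infinity>x\<in>verts G. F x * cnj (H x))"

definition l2_norm :: "'v graph \<Rightarrow> ('v \<Rightarrow> complex) \<Rightarrow> real" where
  "l2_norm G F = sqrt (\<Sum>\<^sub>\<infinity>x\<in>verts G. (cmod (F x))\<^sup>2)"

definition eigenspace :: "'v graph \<Rightarrow> complex \<Rightarrow> ('v \<Rightarrow> complex) set" where
  "eigenspace G c = {F \<in> l2 G. \<forall>x\<in>verts G. - laplacian G F x = c * F x}"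

definition frame_fun :: "'v graph \<Rightarrow> 'v \<Rightarrow> 'v \<Rightarrow> complex" where
  "frame_fun G z x = complex_of_real (1 / sqrt 3 * (- 1 / 2) ^ graph_dist G x z)"

end

theory Submission
  imports Defs
begin

text \<open>
  The frame functions reproduce \<open>E\<^sub>6\<close> up to a constant: \<open>\<langle>F, F\<^sub>z\<rangle> = \<surd>3 F(z)\<close> for every
  \<open>F \<in> E\<^sub>6\<close> (\<open>l2_inner_frame_fun\<close>). Squaring and summing over \<open>z\<close> gives the theorem.

  The first ingredient is a local description of \<open>E\<^sub>6\<close>. Write \<open>S(v)\<close> for the sum of \<open>F\<close> over the
  three edges at the vertex \<open>v\<close>. The eigenvalue equation at the edge \<open>uv\<close> says
  \<open>S(u) + S(v) = 0\<close>, so \<open>\<bar>S\<bar>\<close> is constant on \<open>\<Gamma>\<close>. As \<open>\<Gamma>\<close> is infinite and \<open>F\<close> is square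
  summable, the constant is zero (\<open>eigenspace_vertex_sum\<close>).

  The second ingredient is a summation by parts, carried out for a fixed edge \<open>z\<close>. Let \<open>k(v)\<close> be
  the distance from the vertex \<open>v\<close> to the nearest endpoint of \<open>z\<close>, and put
  \<open>c(v) = - (-1/2) ^ k(v)\<close>. Since \<open>\<Gamma>\<close> is a tree, the endpoints of an edge \<open>e \<noteq> z\<close> lie on
  consecutive levels (\<open>level_eq_imp_root\<close>), and \<open>d(e, z)\<close> is the larger of the two
  (\<open>graph_dist_root\<close>). If that level is \<open>n + 1\<close>, then
  \<open>c(u) + c(v) = - (-1/2) ^ n - (-1/2) ^ (n + 1) = (-1/2) ^ (n + 1)\<close> for \<open>e = uv\<close>, which is
  \<open>(-1/2) ^ d(e, z)\<close>. At \<open>e = z\<close> the sum is \<open>-2\<close> while \<open>(-1/2) ^ 0 = 1\<close>. Summing \<open>c(v) F(e)\<close>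
  over all pairs of a vertex \<open>v\<close> and an edge \<open>e\<close> at \<open>v\<close>, first over the edges at each vertex and
  then over the endpoints of each edge, yields
  \<open>0 = (\<Sum>e. (-1/2) ^ d(e, z) F(e)) - 3 F(z)\<close>. The two orders of summation agree because \<open>c\<close> is
  square summable: level \<open>n\<close> has at most \<open>2 * 2 ^ n\<close> vertices (\<open>level_card\<close>), each contributing
  \<open>4 ^ (-n)\<close>.
\<close>


section \<open>Non-backtracking walks\<close>

definition nonbacktracking :: "'a list \<Rightarrow> bool" where
  "nonbacktracking p \<longleftrightarrow> (\<forall>i. Suc (Suc i) < length p \<longrightarrow> p ! i \<noteq> p ! Suc (Suc i))"

lemma nonbacktracking_Cons_Cons_Cons:
  "nonbacktracking (x # y # w # p) \<longleftrightarrow> x \<noteq> w \<and> nonbacktracking (y # w # p)"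
proof
  assume "nonbacktracking (x # y # w # p)"
  then have *: "\<And>i. Suc (Suc i) < length (x # y # w # p) \<Longrightarrow>
      (x # y # w # p) ! i \<noteq> (x # y # w # p) ! Suc (Suc i)"
    unfolding nonbacktracking_def by blast
  show "x \<noteq> w \<and> nonbacktracking (y # w # p)"
    unfolding nonbacktracking_def using *[of 0] *[of "Suc _"] by simp
next
  assume *: "x \<noteq> w \<and> nonbacktracking (y # w # p)"
  show "nonbacktracking (x # y # w # p)"
    unfolding nonbacktracking_def
  proof (intro allI impI)
    fix i assume i: "Suc (Suc i) < length (x # y # w # p)"
    show "(x # y # w # p) ! i \<noteq> (x # y # w # p) ! Suc (Suc i)"
      using * i by (cases i) (auto simp: nonbacktracking_def)
  qed
qed

lemma nonbacktracking_short: "length p \<le> 2 \<Longrightarrow> nonbacktracking p"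
  by (simp add: nonbacktracking_def)

lemma nonbacktracking_tl: "nonbacktracking (x # p) \<Longrightarrow> nonbacktracking p"
  unfolding nonbacktracking_def by (metis Suc_less_eq length_Cons nth_Cons_Suc)

lemma nonbacktracking_if_map: "nonbacktracking (map f p) \<Longrightarrow> nonbacktracking p"
  by (auto simp: nonbacktracking_def)

lemma simple_graph_no_loop: "simple_graph G \<Longrightarrow> {x, y} \<in> edges G \<Longrightarrow> x \<noteq> y"
  by (auto simp: simple_graph_def)

lemma simple_graph_edge_verts:
  "simple_graph G \<Longrightarrow> {x, y} \<in> edges G \<Longrightarrow> x \<in> verts G \<and> y \<in> verts G"
  by (auto simp: simple_graph_def)

lemma walk_Cons:
  "walk G (x # p) \<longleftrightarrow> x \<in> verts G \<and> (p = [] \<or> walk G p \<and> {x, hd p} \<in> edges G)"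
  by (cases p) (auto simp: walk_def)

lemma walk_not_Nil: "walk G p \<Longrightarrow> p \<noteq> []"
  by (simp add: walk_def)

lemma walk_append:
  assumes "p \<noteq> []" "q \<noteq> []"
  shows "walk G (p @ q) \<longleftrightarrow> walk G p \<and> walk G q \<and> {last p, hd q} \<in> edges G"
  using assms by (auto simp: walk_def successively_append_iff)

lemma walk_rev: "walk G (rev p) \<longleftrightarrow> walk G p"
  by (auto simp: walk_def insert_commute)

text \<open>The first return of such a walk to its starting point would close a cycle: the return takes
  at least three steps, one step being excluded because there are no loops, two steps because the
  walk does not turn around.\<close>

lemma nonbacktracking_walk_distinct:
  assumes G: "simple_graph G" "\<nexists>c. cycle G c"
    and "walk G p" "nonbacktracking p"
  shows "distinct p"
  using assms(3,4)
proof (induction p)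
  case (Cons x p)
  show ?case
  proof (cases "p = []")
    case False
    then have p: "walk G p" "{x, hd p} \<in> edges G"
      using Cons.prems(1) by (auto simp: walk_Cons)
    have dist: "distinct p"
      using Cons.IH p(1) nonbacktracking_tl[OF Cons.prems(2)] by blast
    have "x \<notin> set p"
    proof
      assume "x \<in> set p"
      then obtain ys zs where split: "p = ys @ x # zs"
        by (meson split_list)
      have "length ys \<noteq> 0"
        using p(2) split simple_graph_no_loop[OF G(1), of x x] by auto
      moreover have "length ys \<noteq> 1"
        using Cons.prems(2) split
        by (auto simp: length_Suc_conv nonbacktracking_Cons_Cons_Cons)
      ultimately have "2 \<le> length ys"
        by linarith
      then have len: "3 \<le> length (ys @ [x])" and ys: "ys \<noteq> []"
        by auto
      have "walk G (ys @ [x])"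
      proof (cases "zs = []")
        case False
        then show ?thesis
          using p(1) split walk_append[of "ys @ [x]" zs G] by simp
      qed (use p(1) split in simp)
      moreover have "{last (ys @ [x]), hd (ys @ [x])} \<in> edges G"
        using p(2) split ys by simp
      moreover have "distinct (ys @ [x])"
        using dist split by auto
      ultimately have "cycle G (ys @ [x])"
        using len by (simp add: cycle_def)
      then show False
        using G(2) by blast
    qed
    then show ?thesis
      using dist by simp
  qed simp
qed (simp add: walk_def)

lemma nonbacktracking_walk_not_closing:
  assumes G: "simple_graph G" "\<nexists>c. cycle G c"
    and p: "walk G p" "nonbacktracking p" "3 \<le> length p"
  shows "hd p \<noteq> last p" and "{last p, hd p} \<notin> edges G"
proof -
  have dist: "distinct p"
    by (rule nonbacktracking_walk_distinct[OF G p(1,2)])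
  obtain x q where "p = x # q" "q \<noteq> []"
    using p(3) by (cases p; cases "tl p") auto
  then show "hd p \<noteq> last p"
    using dist by auto
  show "{last p, hd p} \<notin> edges G"
    using G(2) p(1,3) dist by (auto simp: cycle_def)
qed


section \<open>Distance to a set of vertices\<close>

definition set_dist :: "'v graph \<Rightarrow> 'v set \<Rightarrow> 'v \<Rightarrow> nat" where
  "set_dist G S x = (LEAST n. \<exists>p. walk G p \<and> hd p = x \<and> last p \<in> S \<and> length p = Suc n)"

lemma set_dist_le: "walk G p \<Longrightarrow> last p \<in> S \<Longrightarrow> set_dist G S (hd p) \<le> length p - 1"
  unfolding set_dist_def by (rule Least_le) (auto simp: walk_def)

lemma set_dist_attained:
  assumes "connected_graph G" "x \<in> verts G" "S \<inter> verts G \<noteq> {}"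
  obtains p where "walk G p" "hd p = x" "last p \<in> S" "length p = Suc (set_dist G S x)"
proof -
  obtain s p where "s \<in> S" "walk G p" "hd p = x" "last p = s"
    using assms unfolding connected_graph_def walk_between_def by blast
  moreover from this have "length p = Suc (length p - 1)"
    by (cases p) (auto simp: walk_def)
  ultimately have "\<exists>n p. walk G p \<and> hd p = x \<and> last p \<in> S \<and> length p = Suc n"
    by blast
  from LeastI_ex[OF this] show thesis
    using that unfolding set_dist_def by blast
qed

lemma set_dist_eq_0:
  assumes "connected_graph G" "S \<subseteq> verts G" "S \<noteq> {}" "x \<in> verts G"
  shows "set_dist G S x = 0 \<longleftrightarrow> x \<in> S"
proof
  assume 0: "set_dist G S x = 0"
  obtain p where "hd p = x" "last p \<in> S" "length p = Suc 0"
    using set_dist_attained[OF assms(1,4), of S] assms(2,3) 0 by (metis inf.absorb1)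
  then show "x \<in> S"
    by (cases p) auto
next
  assume "x \<in> S"
  then show "set_dist G S x = 0"
    using set_dist_le[of G "[x]" S] assms(4) by (simp add: walk_def)
qed

lemma set_dist_step:
  assumes "connected_graph G" "S \<subseteq> verts G" "S \<noteq> {}"
    and "x \<in> verts G" "y \<in> verts G" "{x, y} \<in> edges G"
  shows "set_dist G S x \<le> Suc (set_dist G S y)"
proof -
  obtain p where p: "walk G p" "hd p = y" "last p \<in> S" "length p = Suc (set_dist G S y)"
    using set_dist_attained[OF assms(1,5), of S] assms(2,3) by (metis inf.absorb1)
  then show ?thesis
    using set_dist_le[of G "x # p" S] assms(4,6) walk_not_Nil[OF p(1)] by (auto simp: walk_Cons)
qed

lemma set_dist_descend:
  assumes "connected_graph G" "S \<subseteq> verts G" "S \<noteq> {}"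
    and "x \<in> verts G" "set_dist G S x = Suc n"
  obtains y where "y \<in> verts G" "{x, y} \<in> edges G" "set_dist G S y = n"
proof -
  obtain p where p: "walk G p" "hd p = x" "last p \<in> S" "length p = Suc (Suc n)"
    using set_dist_attained[OF assms(1,4), of S] assms(2,3,5) by (metis inf.absorb1)
  then obtain y q where pq: "p = x # y # q"
    by (cases p; cases "tl p") auto
  then have y: "y \<in> verts G" "{x, y} \<in> edges G"
    using p(1) by (auto simp: walk_def)
  have "set_dist G S y \<le> n"
    using set_dist_le[of G "y # q" S] p pq by (simp add: walk_Cons)
  moreover have "Suc n \<le> Suc (set_dist G S y)"
    using set_dist_step[OF assms(1-4) y] assms(5) by simp
  ultimately show thesis
    using that y by force
qed

text \<open>These three properties pin the distance down: \<open>L\<close> drops by at most one per step of a walk,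
  so a walk from \<open>x\<close> to \<open>z\<close> has at least \<open>L x\<close> steps, and repeatedly passing to a neighbour of
  smaller value gives a walk with exactly that many.\<close>

lemma graph_dist_eqI:
  assumes zero: "\<And>x. x \<in> verts G \<Longrightarrow> L x = 0 \<longleftrightarrow> x = z"
    and step: "\<And>x y. x \<in> verts G \<Longrightarrow> y \<in> verts G \<Longrightarrow> {x, y} \<in> edges G \<Longrightarrow> L x \<le> Suc (L y)"
    and descend: "\<And>x n. x \<in> verts G \<Longrightarrow> L x = Suc n \<Longrightarrow>
      \<exists>y\<in>verts G. {x, y} \<in> edges G \<and> L y = n"
    and x: "x \<in> verts G"
  shows "graph_dist G x z = L x"
  unfolding graph_dist_def
proof (rule Least_equality)
  have "\<exists>p. walk_between G x p z \<and> length p = Suc n" if "x \<in> verts G" "L x = n" for x n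
    using that
  proof (induction n arbitrary: x)
    case 0
    then show ?case
      using zero by (intro exI[of _ "[x]"]) (auto simp: walk_between_def walk_def)
  next
    case (Suc n)
    then obtain y p where "{x, y} \<in> edges G" "walk_between G y p z" "length p = Suc n"
      using descend by meson
    then show ?case
      using Suc.prems(1)
      by (intro exI[of _ "x # p"]) (auto simp: walk_between_def walk_Cons dest: walk_not_Nil)
  qed
  then show "\<exists>p. walk_between G x p z \<and> length p = Suc (L x)"
    using x by blast
next
  fix n assume "\<exists>p. walk_between G x p z \<and> length p = Suc n"
  then obtain p where p: "walk_between G x p z" "length p = Suc n"
    by blast
  have "L (hd p) < length p" if "walk G p" "last p = z" for p
    using that
  proof (induction p)
    case (Cons w p)
    show ?case
    proof (cases "p = []")
      case True
      then show ?thesis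
        using Cons.prems zero by (auto simp: walk_def)
    next
      case False
      then have "walk G p" "{w, hd p} \<in> edges G" "w \<in> verts G" "hd p \<in> verts G"
        using Cons.prems(1) by (auto simp: walk_Cons) (auto simp: walk_def)
      then show ?thesis
        using Cons.IH Cons.prems(2) False step[of w "hd p"] by force
    qed
  qed (simp add: walk_def)
  then show "L x \<le> n"
    using p by (force simp: walk_between_def)
qed


section \<open>Edges of the cubic tree\<close>

definition incident :: "'v graph \<Rightarrow> 'v \<Rightarrow> 'v set set" where
  "incident G v = {e \<in> edges G. v \<in> e}"

locale cubic_tree =
  fixes \<Gamma> :: "'v graph"
  assumes is_tree: "tree \<Gamma>" and cubic: "regular 3 \<Gamma>"
begin

lemma simple: "simple_graph \<Gamma>" and connected: "connected_graph \<Gamma>" and acyclic: "\<nexists>c. cycle \<Gamma> c"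
  using is_tree by (auto simp: tree_def)

lemmas edge_verts = simple_graph_edge_verts[OF simple]
  and no_loop = simple_graph_no_loop[OF simple]

lemma edge_obtain:
  assumes "e \<in> edges \<Gamma>"
  obtains u v where "e = {u, v}" "u \<noteq> v" "u \<in> verts \<Gamma>" "v \<in> verts \<Gamma>"
  using assms simple unfolding simple_graph_def card_2_iff
  by (metis insert_subset)

lemma neighbours_verts: "y \<in> neighbours \<Gamma> x \<Longrightarrow> x \<in> verts \<Gamma> \<and> y \<in> verts \<Gamma>"
  using edge_verts by (auto simp: neighbours_def)

lemma neighbours_finite: "v \<in> verts \<Gamma> \<Longrightarrow> finite (neighbours \<Gamma> v)"
  and neighbours_card: "v \<in> verts \<Gamma> \<Longrightarrow> card (neighbours \<Gamma> v) = 3"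
  using cubic by (auto simp: regular_def)

lemma incident_image: "incident \<Gamma> v = (\<lambda>y. {v, y}) ` neighbours \<Gamma> v"
proof
  show "incident \<Gamma> v \<subseteq> (\<lambda>y. {v, y}) ` neighbours \<Gamma> v"
  proof
    fix e assume e: "e \<in> incident \<Gamma> v"
    then obtain u w where "e = {u, w}"
      using edge_obtain unfolding incident_def by blast
    then show "e \<in> (\<lambda>y. {v, y}) ` neighbours \<Gamma> v"
      using e by (auto simp: incident_def neighbours_def insert_commute)
  qed
qed (auto simp: incident_def neighbours_def)

lemma incident_finite: "v \<in> verts \<Gamma> \<Longrightarrow> finite (incident \<Gamma> v)"
  by (simp add: incident_image neighbours_finite)

lemma incident_card: "v \<in> verts \<Gamma> \<Longrightarrow> card (incident \<Gamma> v) = 3"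
  unfolding incident_image
  by (subst card_image) (auto simp: inj_on_def doubleton_eq_iff neighbours_card)

text \<open>A walk is prolonged at its head: of the three neighbours of the head, at most one is ruled out
  by the preceding step.\<close>

lemma long_nonbacktracking_walk: "\<exists>p. walk \<Gamma> p \<and> nonbacktracking p \<and> length p = Suc n"
proof (induction n)
  case 0
  obtain x where "x \<in> verts \<Gamma>"
    using connected by (auto simp: connected_graph_def)
  then show ?case
    by (intro exI[of _ "[x]"]) (auto simp: walk_def nonbacktracking_def)
next
  case (Suc n)
  then obtain x q where q: "walk \<Gamma> (x # q)" "nonbacktracking (x # q)" "length (x # q) = Suc n"
    by (metis Suc_length_conv)
  then have "card (neighbours \<Gamma> x - set (take 1 q)) > 0"
    using diff_card_le_card_Diff[of "set (take 1 q)" "neighbours \<Gamma> x"]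
      card_length[of "take 1 q"] neighbours_card[of x]
    by (auto simp: walk_Cons)
  then obtain y where y: "y \<in> neighbours \<Gamma> x" "y \<notin> set (take 1 q)"
    by (metis Diff_iff all_not_in_conv card.empty less_numeral_extra(3))
  have "walk \<Gamma> (y # x # q)"
    using q(1) y(1) neighbours_verts by (auto simp: walk_Cons neighbours_def insert_commute)
  moreover have "nonbacktracking (y # x # q)"
    using q(2) y(2)
    by (cases q) (auto simp: nonbacktracking_Cons_Cons_Cons nonbacktracking_short)
  ultimately show ?case
    using q(3) by (intro exI[of _ "y # x # q"]) simp
qed

lemma infinite_verts: "infinite (verts \<Gamma>)"
proof
  assume fin: "finite (verts \<Gamma>)"
  obtain p where p: "walk \<Gamma> p" "nonbacktracking p" "length p = Suc (card (verts \<Gamma>))"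
    using long_nonbacktracking_walk by blast
  have "card (set p) = length p"
    using nonbacktracking_walk_distinct[OF simple acyclic p(1,2)] by (rule distinct_card)
  moreover have "card (set p) \<le> card (verts \<Gamma>)"
    using p(1) fin by (intro card_mono) (auto simp: walk_def)
  ultimately show False
    using p(3) by simp
qed

lemma adjacent_edges_iff:
  "{e, f} \<in> edges (edge_graph \<Gamma>) \<longleftrightarrow> e \<in> edges \<Gamma> \<and> f \<in> edges \<Gamma> \<and> e \<noteq> f \<and> e \<inter> f \<noteq> {}"
  by (auto simp: edge_graph_def doubleton_eq_iff)

lemma neighbours_edge_graph:
  assumes uv: "{u, v} \<in> edges \<Gamma>"
  shows "neighbours (edge_graph \<Gamma>) {u, v} = (incident \<Gamma> u - {{u, v}}) \<union> (incident \<Gamma> v - {{u, v}})"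
    and "(incident \<Gamma> u - {{u, v}}) \<inter> (incident \<Gamma> v - {{u, v}}) = {}"
proof -
  show "neighbours (edge_graph \<Gamma>) {u, v} = (incident \<Gamma> u - {{u, v}}) \<union> (incident \<Gamma> v - {{u, v}})"
    using uv by (auto simp: neighbours_def adjacent_edges_iff incident_def)
  have "e = {u, v}" if "e \<in> edges \<Gamma>" "u \<in> e" "v \<in> e" for e
    using that no_loop[OF uv] by (elim edge_obtain) auto
  then show "(incident \<Gamma> u - {{u, v}}) \<inter> (incident \<Gamma> v - {{u, v}}) = {}"
    by (auto simp: incident_def)
qed

definition vertex_sum :: "('v set \<Rightarrow> complex) \<Rightarrow> 'v \<Rightarrow> complex" where
  "vertex_sum F v = (\<Sum>e\<in>incident \<Gamma> v. F e)"

lemma laplacian_edge_graph: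
  assumes uv: "{u, v} \<in> edges \<Gamma>"
  shows "laplacian (edge_graph \<Gamma>) F {u, v} = vertex_sum F u + vertex_sum F v - 6 * F {u, v}"
proof -
  let ?e = "{u, v}"
  have half: "(\<Sum>f\<in>incident \<Gamma> w - {?e}. F f - F ?e) = vertex_sum F w - 3 * F ?e"
    and fin: "finite (incident \<Gamma> w)" if w: "w \<in> ?e" for w
  proof -
    have wv: "w \<in> verts \<Gamma>" and e: "?e \<in> incident \<Gamma> w"
      using w uv edge_verts[OF uv] by (auto simp: incident_def)
    show "finite (incident \<Gamma> w)"
      using incident_finite[OF wv] .
    have "(\<Sum>f\<in>incident \<Gamma> w - {?e}. F f - F ?e) = (\<Sum>f\<in>incident \<Gamma> w. F f - F ?e)"
      by (intro sum.mono_neutral_left incident_finite wv) auto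
    also have "\<dots> = vertex_sum F w - 3 * F ?e"
      by (simp add: sum_subtractf vertex_sum_def incident_card[OF wv])
    finally show "(\<Sum>f\<in>incident \<Gamma> w - {?e}. F f - F ?e) = vertex_sum F w - 3 * F ?e" .
  qed
  have "laplacian (edge_graph \<Gamma>) F ?e =
      (\<Sum>f\<in>incident \<Gamma> u - {?e}. F f - F ?e) + (\<Sum>f\<in>incident \<Gamma> v - {?e}. F f - F ?e)"
    unfolding laplacian_def neighbours_edge_graph(1)[OF uv]
    by (rule sum.union_disjoint) (use fin neighbours_edge_graph(2)[OF uv] in auto)
  then show ?thesis
    by (simp add: half)
qed

text \<open>On \<open>E\<^sub>6\<close> the vertex sums at adjacent vertices are opposite, so their modulus is a constant
  \<open>s\<close>. If \<open>s\<close> were positive, every vertex would lie on an edge where \<open>F\<close> has modulus at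
  least \<open>s / 3\<close>. A square summable function has only finitely many such edges, and they cannot
  cover the infinitely many vertices.\<close>

lemma eigenspace_vertex_sum:
  assumes F: "F \<in> eigenspace (edge_graph \<Gamma>) 6" and v: "v \<in> verts \<Gamma>"
  shows "vertex_sum F v = 0"
proof (rule ccontr)
  assume nz: "vertex_sum F v \<noteq> 0"
  define s where "s = cmod (vertex_sum F v)"
  have s: "s > 0"
    using nz by (simp add: s_def)
  have opp: "cmod (vertex_sum F x) = cmod (vertex_sum F y)" if xy: "{x, y} \<in> edges \<Gamma>" for x y
  proof -
    have "- laplacian (edge_graph \<Gamma>) F {x, y} = 6 * F {x, y}"
      using F xy by (auto simp: eigenspace_def edge_graph_def)
    then have "vertex_sum F x = - vertex_sum F y"
      unfolding laplacian_edge_graph[OF xy] by (simp add: algebra_simps eq_neg_iff_add_eq_0)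
    then show ?thesis
      by simp
  qed
  have along: "cmod (vertex_sum F (hd p)) = cmod (vertex_sum F (last p))" if "walk \<Gamma> p" for p
    using that by (induction p) (auto simp: walk_Cons dest: opp walk_not_Nil)
  have const: "cmod (vertex_sum F w) = s" if "w \<in> verts \<Gamma>" for w
    using connected that v along unfolding connected_graph_def walk_between_def s_def by metis
  define B where "B = {e \<in> edges \<Gamma>. s / 3 \<le> cmod (F e)}"
  have L2: "(\<lambda>e. (cmod (F e))\<^sup>2) summable_on edges \<Gamma>"
    using F by (simp add: eigenspace_def l2_def edge_graph_def)
  define M where "M = (\<Sum>\<^sub>\<infinity>e\<in>edges \<Gamma>. (cmod (F e))\<^sup>2)"
  have bound: "real (card A) * (s / 3)\<^sup>2 \<le> M" if A: "finite A" "A \<subseteq> B" for A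
  proof -
    have "real (card A) * (s / 3)\<^sup>2 = (\<Sum>e\<in>A. (s / 3)\<^sup>2)"
      by simp
    also have "\<dots> \<le> (\<Sum>e\<in>A. (cmod (F e))\<^sup>2)"
      using A(2) s by (intro sum_mono power_mono) (auto simp: B_def)
    also have "\<dots> \<le> M"
      unfolding M_def using A by (intro finite_sum_le_infsum L2) (auto simp: B_def)
    finally show ?thesis .
  qed
  have "finite B"
  proof (rule ccontr)
    assume "infinite B"
    obtain n where "M < real n * (s / 3)\<^sup>2"
      using s reals_Archimedean3[of "(s / 3)\<^sup>2"] by auto
    moreover obtain A where "A \<subseteq> B" "finite A" "card A = n"
      using infinite_arbitrarily_large[OF \<open>infinite B\<close>] by blast
    ultimately show False
      using bound[of A] by simp
  qed
  then have "finite (\<Union>B)"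
    by (rule finite_Union) (auto simp: B_def elim: edge_obtain)
  moreover have "verts \<Gamma> \<subseteq> \<Union>B"
  proof
    fix w assume w: "w \<in> verts \<Gamma>"
    have "\<exists>e\<in>incident \<Gamma> w. s / 3 \<le> cmod (F e)"
    proof (rule ccontr)
      assume "\<not> ?thesis"
      then have small: "cmod (F e) < s / 3" if "e \<in> incident \<Gamma> w" for e
        using that by force
      have "s \<le> (\<Sum>e\<in>incident \<Gamma> w. cmod (F e))"
        unfolding const[OF w, symmetric] vertex_sum_def by (rule norm_sum)
      also have "\<dots> < (\<Sum>e\<in>incident \<Gamma> w. s / 3)"
        using incident_finite[OF w] incident_card[OF w]
        by (intro sum_strict_mono small) auto
      finally show False
        by (simp add: incident_card[OF w])
    qed
    then show "w \<in> \<Union>B"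
      by (auto simp: B_def incident_def)
  qed
  ultimately show False
    using infinite_verts finite_subset by blast
qed

end


section \<open>Levels around a root edge\<close>

locale rooted_cubic_tree = cubic_tree \<Gamma> for \<Gamma> :: "'v graph" +
  fixes z :: "'v set"
  assumes root: "z \<in> edges \<Gamma>"
begin

definition level :: "'v \<Rightarrow> nat" where
  "level = set_dist \<Gamma> z"

lemma root_verts: "z \<subseteq> verts \<Gamma>" "z \<noteq> {}"
  using root by (auto elim: edge_obtain)

lemma level_0: "v \<in> verts \<Gamma> \<Longrightarrow> level v = 0 \<longleftrightarrow> v \<in> z"
  unfolding level_def by (rule set_dist_eq_0[OF connected root_verts])

lemma root_Max_level: "Max (level ` z) = 0"
proof -
  have "level ` z = {0}"
    using root_verts level_0 by (force simp: image_def)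
  then show ?thesis
    by simp
qed

lemma level_step: "{u, v} \<in> edges \<Gamma> \<Longrightarrow> level u \<le> Suc (level v)"
  unfolding level_def using edge_verts by (intro set_dist_step[OF connected root_verts]) auto

lemma level_descend:
  assumes "v \<in> verts \<Gamma>" "level v = Suc n"
  obtains u where "u \<in> verts \<Gamma>" "{v, u} \<in> edges \<Gamma>" "level u = n"
  using assms set_dist_descend[OF connected root_verts] unfolding level_def by metis

lemma descending_walk:
  assumes "v \<in> verts \<Gamma>" "level v = n"
  shows "\<exists>p. walk \<Gamma> p \<and> hd p = v \<and> map level p = rev [0..<Suc n]"
  using assms
proof (induction n arbitrary: v)
  case 0
  then show ?case
    by (intro exI[of _ "[v]"]) (auto simp: walk_def)
next
  case (Suc n)
  then obtain u where u: "u \<in> verts \<Gamma>" "{v, u} \<in> edges \<Gamma>" "level u = n"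
    using level_descend by blast
  then obtain p where "walk \<Gamma> p" "hd p = u" "map level p = rev [0..<Suc n]"
    using Suc.IH by blast
  then show ?case
    using u(2) Suc.prems by (intro exI[of _ "v # p"]) (auto simp: walk_Cons)
qed

text \<open>This is where the absence of cycles enters. If two adjacent vertices had the same positive
  level, a shortest walk from the root edge to one of them, continued across and back down to the
  root edge, would run through the levels \<open>0, \<dots>, n, n, \<dots>, 0\<close>. It cannot turn around, since
  entries two apart in this sequence differ, and its endpoints are equal or joined by \<open>z\<close>.\<close>

lemma level_eq_imp_root:
  assumes uv: "{u, v} \<in> edges \<Gamma>" and eq: "level u = level v"
  shows "{u, v} = z"
proof -
  define n where "n = level u"
  obtain p where p: "walk \<Gamma> p" "hd p = u" "map level p = rev [0..<Suc n]"
    using descending_walk edge_verts[OF uv] n_def by blast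
  obtain q where q: "walk \<Gamma> q" "hd q = v" "map level q = rev [0..<Suc n]"
    using descending_walk edge_verts[OF uv] n_def eq by metis
  have ne: "p \<noteq> []" "q \<noteq> []"
    using p(1) q(1) by (auto simp: walk_def)
  have bottom: "last r \<in> z" if "walk \<Gamma> r" "map level r = rev [0..<Suc n]" for r
  proof -
    have "r \<noteq> []" "last r \<in> verts \<Gamma>"
      using that(1) by (auto simp: walk_def)
    then have "level (last r) = last (rev [0..<Suc n])"
      using that(2) by (metis last_map)
    then have "level (last r) = 0"
      by (simp add: last_rev upt_conv_Cons del: upt_Suc)
    then show ?thesis
      using level_0 \<open>last r \<in> verts \<Gamma>\<close> by blast
  qed
  let ?c = "rev p @ q"
  have walk: "walk \<Gamma> ?c"
    using p q ne uv by (subst walk_append) (auto simp: walk_rev last_rev)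
  have "map level ?c = [0..<Suc n] @ rev [0..<Suc n]"
    using p(3) q(3) by (metis map_append rev_map rev_rev_ident)
  moreover have "nonbacktracking ([0..<Suc n] @ rev [0..<Suc n])"
    unfolding nonbacktracking_def
  proof (intro allI impI)
    fix i
    have "2 * i + 1 \<noteq> 2 * n"
      by presburger
    moreover assume "Suc (Suc i) < length ([0..<Suc n] @ rev [0..<Suc n])"
    ultimately show "([0..<Suc n] @ rev [0..<Suc n]) ! i \<noteq> ([0..<Suc n] @ rev [0..<Suc n]) ! Suc (Suc i)"
      by (auto simp: nth_append rev_nth simp del: upt_Suc)
  qed
  ultimately have nb: "nonbacktracking ?c"
    by (metis nonbacktracking_if_map)
  have ends: "hd ?c \<in> z" "last ?c \<in> z"
    using bottom p q ne by (auto simp: hd_rev)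
  have "length ?c < 3"
  proof (rule ccontr)
    assume "\<not> ?thesis"
    then have "hd ?c \<noteq> last ?c" "{last ?c, hd ?c} \<notin> edges \<Gamma>"
      using nonbacktracking_walk_not_closing[OF simple acyclic walk nb] by auto
    moreover obtain a b where "z = {a, b}"
      using root by (elim edge_obtain)
    ultimately show False
      using ends root by (auto simp: insert_commute)
  qed
  moreover have "length p = Suc n" "length q = Suc n"
    using arg_cong[OF p(3), of length] arg_cong[OF q(3), of length] by simp_all
  ultimately have "n = 0"
    by simp
  then have "u \<in> z" "v \<in> z"
    using level_0[of u] level_0[of v] edge_verts[OF uv] eq n_def by auto
  then show ?thesis
    using no_loop[OF uv] root by (elim edge_obtain) auto
qed

lemma nonroot_edge_obtain:
  assumes "e \<in> edges \<Gamma>" "e \<noteq> z"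
  obtains u v where "e = {u, v}" "u \<in> verts \<Gamma>" "v \<in> verts \<Gamma>" "level u = Suc (level v)"
proof -
  obtain x y where xy: "e = {x, y}" "x \<in> verts \<Gamma>" "y \<in> verts \<Gamma>"
    using assms(1) by (elim edge_obtain)
  then have "{x, y} \<in> edges \<Gamma>" "{y, x} \<in> edges \<Gamma>"
    using assms(1) by (auto simp: insert_commute)
  moreover from this have "level x \<noteq> level y"
    using level_eq_imp_root xy(1) assms(2) by blast
  ultimately have "level x = Suc (level y) \<or> level y = Suc (level x)"
    using level_step[of x y] level_step[of y x] by linarith
  then show thesis
    using that xy by (metis insert_commute)
qed

text \<open>Adjacent edges share a vertex, and the other endpoint of each is at most one level deeper, so
  the larger endpoint level changes by at most one. Going towards \<open>z\<close>, the next edge is the one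
  that leads from the shallower endpoint to the previous level, or \<open>z\<close> itself once that endpoint
  lies on \<open>z\<close>.\<close>

lemma graph_dist_root:
  assumes e: "e \<in> edges \<Gamma>"
  shows "graph_dist (edge_graph \<Gamma>) e z = Max (level ` e)"
proof (rule graph_dist_eqI)
  show "e \<in> verts (edge_graph \<Gamma>)"
    using e by (simp add: edge_graph_def)
next
  fix e assume "e \<in> verts (edge_graph \<Gamma>)"
  then have e: "e \<in> edges \<Gamma>"
    by (simp add: edge_graph_def)
  show "Max (level ` e) = 0 \<longleftrightarrow> e = z"
  proof (cases "e = z")
    case True
    then show ?thesis
      using root_Max_level by simp
  next
    case False
    then show ?thesis
      using e by (elim nonroot_edge_obtain) auto
  qed
next
  fix e f assume ef: "{e, f} \<in> edges (edge_graph \<Gamma>)"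
  then obtain v where "v \<in> e" "v \<in> f" and E: "e \<in> edges \<Gamma>" "f \<in> edges \<Gamma>"
    by (auto simp: adjacent_edges_iff)
  then have "e \<in> incident \<Gamma> v" "f \<in> incident \<Gamma> v"
    by (auto simp: incident_def)
  then obtain u w where uw: "e = {v, u}" "f = {v, w}"
    by (auto simp: incident_image)
  then have "level u \<le> Suc (level v)"
    using E by (intro level_step) (simp add: insert_commute)
  then show "Max (level ` e) \<le> Suc (Max (level ` f))"
    using uw by (auto simp: max_def)
next
  fix e n assume "e \<in> verts (edge_graph \<Gamma>)" and n: "Max (level ` e) = Suc n"
  then have e: "e \<in> edges \<Gamma>"
    by (simp add: edge_graph_def)
  have "e \<noteq> z"
    using n root_Max_level by auto
  then obtain u v where uv: "e = {u, v}" "v \<in> verts \<Gamma>" "level u = Suc (level v)"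
    using e by (elim nonroot_edge_obtain)
  then have v: "level v = n"
    using n by simp
  have "\<exists>f\<in>edges \<Gamma>. v \<in> f \<and> Max (level ` f) = n"
  proof (cases n)
    case 0
    then show ?thesis
      using v level_0[OF uv(2)] root root_Max_level by auto
  next
    case (Suc m)
    then obtain w where "{v, w} \<in> edges \<Gamma>" "level w = m"
      using level_descend uv(2) v by metis
    then show ?thesis
      using v Suc by (intro bexI[of _ "{v, w}"]) auto
  qed
  then obtain f where f: "f \<in> edges \<Gamma>" "v \<in> f" "Max (level ` f) = n"
    by blast
  then have "{e, f} \<in> edges (edge_graph \<Gamma>)"
    using e n uv(1) by (auto simp: adjacent_edges_iff)
  then show "\<exists>f\<in>verts (edge_graph \<Gamma>). {e, f} \<in> edges (edge_graph \<Gamma>) \<and> Max (level ` f) = n"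
    using f by (intro bexI[of _ f]) (auto simp: edge_graph_def)
qed

text \<open>Every vertex has a neighbour that is not on the next level: one on the previous level, or
  the other endpoint of the root edge. So at most two of its neighbours are on the next level, and
  the bound on the size of the levels follows by induction.\<close>

lemma level_card: "finite {v \<in> verts \<Gamma>. level v = n} \<and> card {v \<in> verts \<Gamma>. level v = n} \<le> 2 * 2 ^ n"
proof (induction n)
  case 0
  have "{v \<in> verts \<Gamma>. level v = 0} = z"
    using level_0 root_verts by auto
  then show ?case
    using simple root by (auto simp: simple_graph_def card_2_iff)
next
  case (Suc n)
  let ?A = "{v \<in> verts \<Gamma>. level v = n}" and ?B = "{v \<in> verts \<Gamma>. level v = Suc n}"
  let ?C = "\<lambda>u. {w \<in> neighbours \<Gamma> u. level w = Suc n}"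
  have sub: "?B \<subseteq> (\<Union>u\<in>?A. ?C u)"
  proof
    fix v assume v: "v \<in> ?B"
    then obtain u where "u \<in> verts \<Gamma>" "{v, u} \<in> edges \<Gamma>" "level u = n"
      using level_descend by blast
    then show "v \<in> (\<Union>u\<in>?A. ?C u)"
      using v by (auto simp: neighbours_def insert_commute)
  qed
  have C: "finite (?C u) \<and> card (?C u) \<le> 2" if u: "u \<in> ?A" for u
  proof -
    have "\<exists>w\<in>neighbours \<Gamma> u. level w \<noteq> Suc n"
    proof (cases n)
      case 0
      then have "u \<in> z"
        using u level_0 by auto
      then have "z \<in> incident \<Gamma> u"
        using root by (simp add: incident_def)
      then obtain w where w: "w \<in> neighbours \<Gamma> u" "z = {u, w}"
        by (auto simp: incident_image)
      then have "level w = 0"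
        using level_0[of w] neighbours_verts by auto
      then show ?thesis
        using w(1) by (intro bexI[of _ w]) auto
    next
      case (Suc m)
      then obtain w where "{u, w} \<in> edges \<Gamma>" "level w = m"
        using u level_descend[of u m] by auto
      then show ?thesis
        using Suc by (auto simp: neighbours_def)
    qed
    then obtain w where w: "w \<in> neighbours \<Gamma> u" "level w \<noteq> Suc n"
      by blast
    have fin: "finite (neighbours \<Gamma> u)"
      using u neighbours_finite by blast
    have "card (?C u) \<le> card (neighbours \<Gamma> u - {w})"
      using fin w by (intro card_mono) auto
    then show ?thesis
      using fin w u by (simp add: neighbours_card)
  qed
  have finU: "finite (\<Union>u\<in>?A. ?C u)"
    using Suc C by auto
  have "card ?B \<le> card (\<Union>u\<in>?A. ?C u)"
    using sub finU by (rule card_mono[rotated])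
  also have "\<dots> \<le> (\<Sum>u\<in>?A. card (?C u))"
    using Suc by (intro card_UN_le) auto
  also have "\<dots> \<le> (\<Sum>u\<in>?A. 2)"
    using C by (intro sum_mono) auto
  also have "\<dots> \<le> 2 * 2 ^ Suc n"
    using Suc by simp
  finally show ?case
    using finite_subset[OF sub finU] by blast
qed

lemma summable_on_level: "(\<lambda>v. (1 / 4 :: real) ^ level v) summable_on verts \<Gamma>"
proof (rule nonneg_bdd_above_summable_on)
  have bound: "(\<Sum>v\<in>A. (1 / 4 :: real) ^ level v) \<le> 4" if A: "finite A" "A \<subseteq> verts \<Gamma>" for A
  proof -
    define N where "N = Suc (Max (level ` A))"
    have N: "level v < N" if "v \<in> A" for v
      using A(1) that by (simp add: N_def less_Suc_eq_le)
    have "(\<Sum>v\<in>A. (1 / 4 :: real) ^ level v) =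
        (\<Sum>n<N. \<Sum>v\<in>{v \<in> A. level v = n}. (1 / 4) ^ level v)"
      using A(1) N by (intro sum.group[symmetric]) auto
    also have "\<dots> \<le> (\<Sum>n<N. 2 * (1 / 2) ^ n)"
    proof (rule sum_mono)
      fix n
      have "card {v \<in> A. level v = n} \<le> card {v \<in> verts \<Gamma>. level v = n}"
        using level_card[of n] A(2) by (intro card_mono) auto
      also have "\<dots> \<le> 2 * 2 ^ n"
        using level_card by blast
      finally have "real (card {v \<in> A. level v = n}) \<le> real (2 * 2 ^ n)"
        by (rule of_nat_mono)
      then have "real (card {v \<in> A. level v = n}) * (1 / 4) ^ n \<le> (2 * 2 ^ n) * (1 / 4) ^ n"
        by (intro mult_right_mono) auto
      also have "\<dots> = 2 * (1 / 2) ^ n"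
        by (simp add: power_mult_distrib[symmetric])
      finally show "(\<Sum>v\<in>{v \<in> A. level v = n}. (1 / 4 :: real) ^ level v) \<le> 2 * (1 / 2) ^ n"
        by simp
    qed
    also have "\<dots> = 4 * (1 - (1 / 2) ^ N)"
      by (simp add: sum_distrib_left[symmetric] sum_gp_strict)
    also have "\<dots> \<le> 4"
      by simp
    finally show ?thesis .
  qed
  then show "bdd_above (sum (\<lambda>v. (1 / 4 :: real) ^ level v) ` {A. A \<subseteq> verts \<Gamma> \<and> finite A})"
    by (intro bdd_aboveI[of _ 4]) auto
qed simp


section \<open>The inner product with a frame function\<close>

text \<open>The sign and the ratio \<open>- 1 / 2\<close> are what makes the weights of the endpoints of an edge other
  than \<open>z\<close> add up to \<open>(- 1 / 2) ^ d(e, z)\<close>.\<close>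

definition vertex_weight :: "'v \<Rightarrow> real" where
  "vertex_weight v = - ((- 1 / 2) ^ level v)"

lemma sum_vertex_weight:
  assumes e: "e \<in> edges \<Gamma>"
  shows "(\<Sum>v\<in>e. vertex_weight v) = (- 1 / 2) ^ graph_dist (edge_graph \<Gamma>) e z - (if e = z then 3 else 0)"
proof (cases "e = z")
  case True
  obtain a b where ab: "z = {a, b}" "a \<noteq> b" "a \<in> verts \<Gamma>" "b \<in> verts \<Gamma>"
    using root by (elim edge_obtain)
  then have "level a = 0" "level b = 0"
    using level_0 by auto
  moreover have "(\<Sum>v\<in>z. vertex_weight v) = vertex_weight a + vertex_weight b"
    using ab(1,2) by simp
  ultimately show ?thesis
    by (simp add: True graph_dist_root[OF root] root_Max_level vertex_weight_def)
next
  case False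
  then obtain u v where uv: "e = {u, v}" "level u = Suc (level v)"
    using e by (elim nonroot_edge_obtain)
  then have "u \<noteq> v"
    by auto
  then have "(\<Sum>v\<in>e. vertex_weight v) = vertex_weight u + vertex_weight v"
    by (simp add: uv(1))
  moreover have "Max (level ` e) = level u"
    by (simp add: uv)
  ultimately show ?thesis
    using False by (simp add: graph_dist_root[OF e] vertex_weight_def uv(2))
qed

text \<open>Both iterated sums of \<open>vertex_weight v * F e\<close> over incident pairs are computed: at a vertex
  the terms cancel because \<open>F\<close> has vanishing vertex sums, at an edge the two weights combine by
  \<open>sum_vertex_weight\<close>. Absolute convergence comes from \<open>\<bar>c\<bar> \<bar>F\<bar> \<le> c\<^sup>2 + \<bar>F\<bar>\<^sup>2\<close>, where each
  vertex is counted three times and each edge twice.\<close>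

lemma inner_eigenfunction:
  assumes F: "F \<in> eigenspace (edge_graph \<Gamma>) 6"
  shows "(\<Sum>\<^sub>\<infinity>e\<in>edges \<Gamma>. F e * of_real ((- 1 / 2) ^ graph_dist (edge_graph \<Gamma>) e z)) = 3 * F z"
proof -
  let ?g = "\<lambda>e. (- 1 / 2 :: real) ^ graph_dist (edge_graph \<Gamma>) e z"
  let ?VE = "SIGMA v:verts \<Gamma>. incident \<Gamma> v" and ?EV = "SIGMA e:edges \<Gamma>. e"
  define h where "h = (\<lambda>(v, e). of_real (vertex_weight v) * F e)"
  have L2: "(\<lambda>e. (cmod (F e))\<^sup>2) summable_on edges \<Gamma>"
    using F by (simp add: eigenspace_def l2_def edge_graph_def)
  have edge: "finite e \<and> card e = 2 \<and> e \<subseteq> verts \<Gamma>" if "e \<in> edges \<Gamma>" for e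
    using simple that by (auto simp: simple_graph_def card_2_iff)
  have swap: "?VE = prod.swap ` ?EV"
    using edge by (force simp: incident_def image_iff)
  have sum1: "(\<lambda>(v, e). (vertex_weight v)\<^sup>2) summable_on ?VE"
  proof (rule summable_on_SigmaI)
    fix v assume v: "v \<in> verts \<Gamma>"
    show "((\<lambda>e. case (v, e) of (v, e) \<Rightarrow> (vertex_weight v)\<^sup>2) has_sum 3 * (vertex_weight v)\<^sup>2)
        (incident \<Gamma> v)"
      using has_sum_finite[OF incident_finite[OF v], of "\<lambda>e. (vertex_weight v)\<^sup>2"]
      by (simp add: incident_card[OF v])
  next
    have "(vertex_weight v)\<^sup>2 = (1 / 4) ^ level v" for v
      by (simp add: vertex_weight_def power2_eq_square power_mult_distrib[symmetric])
    then show "(\<lambda>v. 3 * (vertex_weight v)\<^sup>2) summable_on verts \<Gamma>"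
      using summable_on_cmult_right[OF summable_on_level] by simp
  qed auto
  have "(\<lambda>(e, v). (cmod (F e))\<^sup>2) summable_on ?EV"
  proof (rule summable_on_SigmaI)
    fix e assume e: "e \<in> edges \<Gamma>"
    show "((\<lambda>v. case (e, v) of (e, v) \<Rightarrow> (cmod (F e))\<^sup>2) has_sum 2 * (cmod (F e))\<^sup>2) e"
      using has_sum_finite[of e "\<lambda>v. (cmod (F e))\<^sup>2"] edge[OF e] by simp
  next
    show "(\<lambda>e. 2 * (cmod (F e))\<^sup>2) summable_on edges \<Gamma>"
      by (rule summable_on_cmult_right[OF L2])
  qed auto
  then have sum2: "(\<lambda>(v, e). (cmod (F e))\<^sup>2) summable_on ?VE"
    unfolding swap by (subst summable_on_reindex) (auto simp: inj_on_def o_def case_prod_unfold prod.swap_def)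
  have "(\<lambda>x. norm (h x)) summable_on ?VE"
  proof (rule summable_on_comparison_test[OF summable_on_add[OF sum1 sum2]])
    fix x :: "'v \<times> 'v set"
    obtain v e where x: "x = (v, e)"
      by fastforce
    have "0 \<le> (\<bar>vertex_weight v\<bar> - cmod (F e))\<^sup>2" "0 \<le> \<bar>vertex_weight v\<bar> * cmod (F e)"
      by simp_all
    then have "\<bar>vertex_weight v\<bar> * cmod (F e) \<le> (vertex_weight v)\<^sup>2 + (cmod (F e))\<^sup>2"
      unfolding power2_diff power2_abs by linarith
    then show "norm (h x) \<le> (case x of (v, e) \<Rightarrow> (vertex_weight v)\<^sup>2) + (case x of (v, e) \<Rightarrow> (cmod (F e))\<^sup>2)"
      by (simp add: x h_def norm_mult)
  qed auto
  then have VE: "h summable_on ?VE"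
    by (rule abs_summable_summable)
  then have EV: "(\<lambda>(e, v). h (v, e)) summable_on ?EV"
    unfolding swap
    by (subst (asm) summable_on_reindex) (auto simp: inj_on_def o_def case_prod_unfold prod.swap_def)
  have "infsum h ?VE = (\<Sum>\<^sub>\<infinity>v\<in>verts \<Gamma>. \<Sum>\<^sub>\<infinity>e\<in>incident \<Gamma> v. h (v, e))"
    using infsum_Sigma'_banach[of "\<lambda>v e. h (v, e)" "verts \<Gamma>" "incident \<Gamma>"] VE by simp
  also have "\<dots> = (\<Sum>\<^sub>\<infinity>v\<in>verts \<Gamma>. 0)"
  proof (rule infsum_cong)
    fix v assume v: "v \<in> verts \<Gamma>"
    have "(\<Sum>\<^sub>\<infinity>e\<in>incident \<Gamma> v. h (v, e)) = of_real (vertex_weight v) * vertex_sum F v"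
      by (simp add: incident_finite[OF v] h_def vertex_sum_def sum_distrib_left)
    then show "(\<Sum>\<^sub>\<infinity>e\<in>incident \<Gamma> v. h (v, e)) = 0"
      using eigenspace_vertex_sum[OF F v] by simp
  qed
  finally have zero: "infsum h ?VE = 0"
    by simp
  have flags: "(\<Sum>\<^sub>\<infinity>v\<in>e. h (v, e)) = F e * of_real (?g e - (if e = z then 3 else 0))"
    if e: "e \<in> edges \<Gamma>" for e
  proof -
    have "(\<Sum>\<^sub>\<infinity>v\<in>e. h (v, e)) = F e * of_real (\<Sum>v\<in>e. vertex_weight v)"
      using edge[OF e] by (simp add: h_def sum_distrib_left mult.commute)
    then show ?thesis
      by (simp only: sum_vertex_weight[OF e])
  qed
  have "(\<lambda>e. \<Sum>\<^sub>\<infinity>v\<in>e. h (v, e)) summable_on edges \<Gamma>"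
    using summable_on_Sigma_banach[OF EV] by simp
  then have sumE: "(\<lambda>e. F e * of_real (?g e - (if e = z then 3 else 0))) summable_on edges \<Gamma>"
    using flags by (simp cong: summable_on_cong)
  have "infsum h ?VE = (\<Sum>\<^sub>\<infinity>(e, v)\<in>?EV. h (v, e))"
    unfolding swap by (subst infsum_reindex) (auto simp: inj_on_def o_def case_prod_unfold prod.swap_def)
  also have "\<dots> = (\<Sum>\<^sub>\<infinity>e\<in>edges \<Gamma>. \<Sum>\<^sub>\<infinity>v\<in>e. h (v, e))"
    using infsum_Sigma'_banach[OF EV] by simp
  also have "\<dots> = (\<Sum>\<^sub>\<infinity>e\<in>edges \<Gamma>. F e * of_real (?g e - (if e = z then 3 else 0)))"
    by (rule infsum_cong) (rule flags)
  finally have "(\<Sum>\<^sub>\<infinity>e\<in>edges \<Gamma>. F e * of_real (?g e - (if e = z then 3 else 0))) = 0"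
    unfolding zero by (rule sym)
  then have "((\<lambda>e. F e * of_real (?g e - (if e = z then 3 else 0))) has_sum 0) (edges \<Gamma>)"
    using has_sum_infsum[OF sumE] by (simp only:)
  moreover have "((\<lambda>e. if e = z then 3 * F z else 0) has_sum 3 * F z) (edges \<Gamma>)"
    using has_sum_finite[of "{z}" "\<lambda>e. if e = z then 3 * F z else 0"] root
    by (subst has_sum_cong_neutral[where T = "{z}"]) auto
  ultimately have "((\<lambda>e. F e * of_real (?g e - (if e = z then 3 else 0)) +
      (if e = z then 3 * F z else 0)) has_sum 0 + 3 * F z) (edges \<Gamma>)"
    by (rule has_sum_add)
  moreover have "F e * of_real (?g e - (if e = z then 3 else 0)) + (if e = z then 3 * F z else 0) =
      F e * of_real (?g e)" for e
    by (simp add: algebra_simps)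
  ultimately show ?thesis
    by (simp add: infsumI)
qed

lemma l2_inner_frame_fun:
  assumes F: "F \<in> eigenspace (edge_graph \<Gamma>) 6"
  shows "l2_inner (edge_graph \<Gamma>) F (frame_fun (edge_graph \<Gamma>) z) = of_real (sqrt 3) * F z"
proof -
  let ?g = "\<lambda>e. (- 1 / 2 :: real) ^ graph_dist (edge_graph \<Gamma>) e z"
  have "l2_inner (edge_graph \<Gamma>) F (frame_fun (edge_graph \<Gamma>) z) =
      (\<Sum>\<^sub>\<infinity>e\<in>edges \<Gamma>. of_real (1 / sqrt 3) * (F e * of_real (?g e)))"
    unfolding l2_inner_def frame_fun_def complex_cnj_complex_of_real of_real_mult
    by (simp add: edge_graph_def mult.left_commute)
  also have "\<dots> = of_real (1 / sqrt 3) * (3 * F z)"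
    using inner_eigenfunction[OF F] by (simp only: infsum_cmult_right')
  also have "\<dots> = of_real (3 / sqrt 3) * F z"
    by simp
  also have "3 / sqrt 3 = sqrt 3"
    by (rule real_div_sqrt) simp
  finally show ?thesis .
qed

end

theorem theorem4p6:
  fixes \<Gamma> :: "'v graph" and F :: "'v set \<Rightarrow> complex"
  assumes "tree \<Gamma>" and "regular 3 \<Gamma>"
    and "F \<in> eigenspace (edge_graph \<Gamma>) 6"
  shows "((\<lambda>z. (cmod (l2_inner (edge_graph \<Gamma>) F (frame_fun (edge_graph \<Gamma>) z)))\<^sup>2)
           has_sum 3 * (l2_norm (edge_graph \<Gamma>) F)\<^sup>2) (verts (edge_graph \<Gamma>))"
proof -
  let ?E = "verts (edge_graph \<Gamma>)"
  have coeff: "(cmod (l2_inner (edge_graph \<Gamma>) F (frame_fun (edge_graph \<Gamma>) z)))\<^sup>2 = 3 * (cmod (F z))\<^sup>2"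
    if "z \<in> ?E" for z
  proof -
    interpret rooted_cubic_tree \<Gamma> z
      using assms(1,2) that by unfold_locales (simp_all add: edge_graph_def)
    show ?thesis
      by (simp add: l2_inner_frame_fun[OF assms(3)] norm_mult power_mult_distrib)
  qed
  have sums: "((\<lambda>z. 3 * (cmod (F z))\<^sup>2) has_sum 3 * (\<Sum>\<^sub>\<infinity>z\<in>?E. (cmod (F z))\<^sup>2)) ?E"
    using assms(3) by (intro has_sum_cmult_right has_sum_infsum) (simp add: eigenspace_def l2_def)
  have norm: "(l2_norm (edge_graph \<Gamma>) F)\<^sup>2 = (\<Sum>\<^sub>\<infinity>z\<in>?E. (cmod (F z))\<^sup>2)"
    by (simp add: l2_norm_def infsum_nonneg)
  show ?thesis
    unfolding norm by (rule iffD2[OF has_sum_cong sums]) (rule coeff)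
qed

end
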